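(* Let $G$ be a graph of order $n$ with vertices $v_1,\dots,v_n$ and Seidel matrix $S=S(G)$. Then for every vertex $v_i$, $$\mathcal{E}_S(v_i)\le\sqrt{n-1}.$$ Moreover, equality holds for every vertex $v_i$ (simultaneously for all $i=1,\dots,n$) if and only if $S^2=(n-1)I_n$.
   Context: All graphs are finite, simple and undirected; $I_n$ is the identity matrix of order $n$. The Seidel matrix of a graph $G$ with vertex set $\{v_1,\dots,v_n\}$ is the real symmetric $n\times n$ matrix $S(G)=[s_{ij}]$ with $s_{ii}=0$, and for $i\neq j$, $s_{ij}=-1$ if $v_i$ and $v_j$ are adjacent and $s_{ij}=1$ otherwise. For a real symmetric matrix $S$, $|S|=(S^2)^{1/2}$ is the positive semidefinite square root of $S^2$. The vertex Seidel energy of $v_i$ is $\mathcal{E}_S(v_i)=|S(G)|_{ii}$, the $i$-th diagonal entry of $|S(G)|$. *)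

theory Defs
  imports "HOL-Analysis.Analysis"
begin

text \<open>
  A finite simple undirected graph is given by a symmetric and irreflexive adjacency relation
  on a finite type \<open>'n\<close>; the vertices are all elements of the type, so the order is \<open>CARD('n)\<close>.
\<close>

definition simple_graph :: "('n::finite \<Rightarrow> 'n \<Rightarrow> bool) \<Rightarrow> bool" where
  "simple_graph adj \<longleftrightarrow> symp adj \<and> irreflp adj"

definition seidel_matrix :: "('n::finite \<Rightarrow> 'n \<Rightarrow> bool) \<Rightarrow> real ^ 'n ^ 'n" where
  "seidel_matrix adj = (\<chi> i j. if i = j then 0 else if adj i j then - 1 else 1)"

definition pos_semidef :: "real ^ 'n ^ 'n \<Rightarrow> bool" where
  "pos_semidef A \<longleftrightarrow> transpose A = A \<and> (\<forall>x. 0 \<le> x \<bullet> (A *v x))"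

text \<open>
  A positive semidefinite matrix has exactly one positive semidefinite square root. On other
  matrices the value of \<open>psd_sqrt\<close> is meaningless.
\<close>

definition psd_sqrt :: "real ^ 'n ^ 'n \<Rightarrow> real ^ 'n ^ 'n" where
  "psd_sqrt A = (THE B. pos_semidef B \<and> B ** B = A)"

definition matrix_abs :: "real ^ 'n ^ 'n \<Rightarrow> real ^ 'n ^ 'n" where
  "matrix_abs S = psd_sqrt (S ** S)"

definition vertex_seidel_energy :: "('n::finite \<Rightarrow> 'n \<Rightarrow> bool) \<Rightarrow> 'n \<Rightarrow> real" where
  "vertex_seidel_energy adj i = matrix_abs (seidel_matrix adj) $ i $ i"

end

theory Submission
  imports Defs
begin

text \<open>
  The square root is produced by polar decomposition: among the orthogonal matrices \<open>U\<close>, one that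
  maximises the trace of \<open>S U\<close> makes \<open>P = S U\<close> positive semidefinite, as is seen by comparing \<open>U\<close>
  with \<open>U\<close> times one or two Householder reflections, and \<open>P\<^sup>2 = S\<^sup>2\<close>. For \<open>P = |S|\<close>, the squares
  of the entries in each row add up to the diagonal entry \<open>n - 1\<close> of \<open>S\<^sup>2\<close>, which bounds \<open>P\<^sub>i\<^sub>i\<close>.
  Equality in every row says that \<open>P\<close> is diagonal, hence equal to \<open>\<surd>(n - 1) I\<close>.
\<close>

section \<open>Rank-one matrices and Householder reflections\<close>

definition outer :: "real ^ 'n \<Rightarrow> real ^ 'n \<Rightarrow> real ^ 'n ^ 'n" where
  "outer a b = (\<chi> i j. a $ i * b $ j)"

lemma outer_mult_outer: "outer a b ** outer c d = (b \<bullet> c) *\<^sub>R outer a d"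
  by (simp add: outer_def matrix_matrix_mult_def inner_vec_def vec_eq_iff sum_distrib_left mult_ac)

lemma trace_mult_outer: "trace (P ** outer a b) = b \<bullet> (P *v a)"
  by (simp add: outer_def trace_def matrix_matrix_mult_def matrix_vector_mult_def inner_vec_def
      sum_distrib_left mult_ac)

lemma trace_scaleR: "trace (c *\<^sub>R A) = c * trace (A :: real ^ 'n ^ 'n)"
  by (simp add: trace_def sum_distrib_left)

lemmas matrix_mult_scaleR = scalar_matrix_assoc[symmetric] matrix_scalar_ac

lemma matrix_mult_diff_left: "(A - B) ** C = A ** C - B ** C" for A B C :: "real ^ 'n ^ 'n"
  by (simp add: matrix_matrix_mult_def vec_eq_iff sum_subtractf algebra_simps)

lemma matrix_mult_diff_right: "A ** (B - C) = A ** B - A ** C" for A B C :: "real ^ 'n ^ 'n"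
  by (simp add: matrix_matrix_mult_def vec_eq_iff sum_subtractf algebra_simps)

text \<open>For nonzero \<open>v\<close>, the reflection in the hyperplane orthogonal to
  \<open>v\<close>.\<close>

definition householder :: "real ^ 'n \<Rightarrow> real ^ 'n ^ 'n" where
  "householder v = mat 1 - (2 / (v \<bullet> v)) *\<^sub>R outer v v"

lemma householder_involution:
  assumes "v \<noteq> 0"
  shows "householder v ** householder v = mat 1"
proof -
  have "householder v ** householder v
      = mat 1 - (4 / (v \<bullet> v)) *\<^sub>R outer v v + (4 / (v \<bullet> v)) *\<^sub>R outer v v"
    using assms
    by (simp add: householder_def matrix_mult_diff_left matrix_mult_diff_right
        matrix_mult_scaleR outer_mult_outer vec_eq_iff)
  then show ?thesis by simp
qed

lemma transpose_householder: "transpose (householder v) = householder v"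
  by (simp add: householder_def outer_def transpose_def vec_eq_iff mat_def mult_ac)

lemma orthogonal_matrix_householder: "v \<noteq> 0 \<Longrightarrow> orthogonal_matrix (householder v)"
  by (simp add: orthogonal_matrix_def transpose_householder householder_involution)

lemma trace_mult_householder:
  "trace (P ** householder v) = trace P - 2 / (v \<bullet> v) * (v \<bullet> (P *v v))"
  by (simp add: householder_def matrix_mult_diff_right matrix_mult_scaleR trace_sub
      trace_scaleR trace_mult_outer)

text \<open>The last term comes from the product of the two rank-one parts. It is the only one that
  can see the antisymmetric part of \<open>P\<close>, since the others are quadratic forms.\<close>

lemma trace_mult_two_householders:
  "trace (P ** (householder v ** householder w)) = trace P - 2 / (v \<bullet> v) * (v \<bullet> (P *v v))
     - 2 / (w \<bullet> w) * (w \<bullet> (P *v w)) + 4 * (v \<bullet> w) / ((v \<bullet> v) * (w \<bullet> w)) * (w \<bullet> (P *v v))"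
  by (simp add: householder_def matrix_mult_diff_left matrix_mult_diff_right
      matrix_mult_scaleR trace_sub trace_scaleR trace_mult_outer
      outer_mult_outer diff_divide_distrib)

section \<open>Existence of the square root by maximising a trace\<close>

lemma compact_orthogonal_matrices: "compact {U :: real ^ 'n ^ 'n. orthogonal_matrix U}"
proof -
  have "bounded {U :: real ^ 'n ^ 'n. orthogonal_matrix U}"
  proof (rule boundedI)
    fix U :: "real ^ 'n ^ 'n"
    assume "U \<in> {U. orthogonal_matrix U}"
    then have "norm (U $ i) = 1" for i
      by (simp add: orthogonal_matrix_orthonormal_rows row_def)
    then show "norm U \<le> sqrt (real CARD('n))"
      by (simp add: norm_vec_def L2_set_def)
  qed
  moreover have "closed {U :: real ^ 'n ^ 'n. orthogonal_matrix U}"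
    \<comment> \<open>Orthogonality is a system of polynomial equations in the entries.\<close>
    unfolding orthogonal_matrix vec_eq_iff matrix_matrix_mult_def transpose_def
    by (simp, intro closed_Collect_all closed_Collect_eq continuous_intros)
  ultimately show ?thesis
    by (simp add: compact_eq_bounded_closed)
qed

text \<open>The antisymmetric part of \<open>P\<close> is of first order in the small rotation made of two reflections,
  while the loss in the trace is of second order.\<close>

lemma pos_semidef_if_trace_maximal:
  fixes P :: "real ^ 'n ^ 'n"
  assumes max: "\<And>Q. orthogonal_matrix Q \<Longrightarrow> trace (P ** Q) \<le> trace P"
  shows "pos_semidef P"
proof -
  \<comment> \<open>A single reflection changes the trace by a negative multiple of the quadratic
    form at \<open>v\<close>.\<close>
  have nonneg: "0 \<le> v \<bullet> (P *v v)" for v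
  proof (cases "v = 0")
    case False
    then have "0 < v \<bullet> v" by simp
    with max[OF orthogonal_matrix_householder[OF False]] show ?thesis
      by (simp add: trace_mult_householder zero_le_divide_iff not_less)
  qed simp
  have two: "2 * (v \<bullet> w) * (w \<bullet> (P *v v)) \<le> (w \<bullet> w) * (v \<bullet> (P *v v)) + (v \<bullet> v) * (w \<bullet> (P *v w))"
    if "v \<noteq> 0" "w \<noteq> 0" for v w
  proof -
    have "orthogonal_matrix (householder v ** householder w)"
      using that by (simp add: orthogonal_matrix_mul orthogonal_matrix_householder)
    from max[OF this]
    have "4 * (v \<bullet> w) / ((v \<bullet> v) * (w \<bullet> w)) * (w \<bullet> (P *v v))
        \<le> 2 / (v \<bullet> v) * (v \<bullet> (P *v v)) + 2 / (w \<bullet> w) * (w \<bullet> (P *v w))"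
      by (simp add: trace_mult_two_householders)
    moreover have "0 < v \<bullet> v" "0 < w \<bullet> w" using that by auto
    ultimately show ?thesis
      by (simp add: divide_simps) (simp add: algebra_simps)
  qed
  have le: "P $ j $ i \<le> P $ i $ j" if "i \<noteq> j" for i j
  proof (rule ccontr)
    define a b d where "a = P $ i $ i" and "b = P $ j $ j" and "d = P $ j $ i - P $ i $ j"
    assume "\<not> P $ j $ i \<le> P $ i $ j"
    then have "0 < d" by (simp add: d_def)
    have entry: "axis k 1 \<bullet> (P *v axis l 1) = P $ k $ l" for k l
      by (simp add: inner_axis' matrix_vector_mul_component inner_axis)
    have "0 \<le> a" "0 \<le> b"
      using nonneg[of "axis i 1"] nonneg[of "axis j 1"] by (simp_all add: a_def b_def entry)
    \<comment> \<open>With \<open>v\<close> and \<open>w\<close> below, \<open>two\<close> reduces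
      to \<open>d \<le> t * (a + b)\<close>. This \<open>t\<close> makes the right side less than
      \<open>d\<close>; the 1 keeps the denominator positive.\<close>
    define t where "t = d / (2 * (a + b + 1))"
    have "0 < t" using \<open>0 < d\<close> \<open>0 \<le> a\<close> \<open>0 \<le> b\<close> by (simp add: t_def)
    define v :: "real ^ 'n" where "v = axis i 1"
    define w :: "real ^ 'n" where "w = axis i 1 + t *\<^sub>R axis j 1"
    have ij: "axis i 1 \<bullet> (axis j 1 :: real ^ 'n) = 0" "axis j 1 \<bullet> (axis i 1 :: real ^ 'n) = 0"
      and one: "axis k 1 \<bullet> (axis k 1 :: real ^ 'n) = 1" for k
      using that by (auto simp: inner_axis_axis)
    have prods: "v \<bullet> v = 1" "v \<bullet> w = 1" "w \<bullet> w = 1 + t\<^sup>2"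
      by (simp_all add: v_def w_def inner_add_left inner_add_right ij one power2_eq_square)
    have forms: "v \<bullet> (P *v v) = a" "w \<bullet> (P *v v) = a + t * P $ j $ i"
      "w \<bullet> (P *v w) = a + t * P $ i $ j + t * (P $ j $ i + t * b)"
      by (simp_all add: v_def w_def inner_add_left inner_add_right matrix_vector_right_distrib
          matrix_vector_mult_scaleR entry a_def b_def distrib_left)
    have "v \<noteq> 0" "w \<noteq> 0"
      using prods by auto
    from two[OF this] have "t * d \<le> t\<^sup>2 * (a + b)"
      unfolding prods forms d_def by (simp add: algebra_simps power2_eq_square)
    then have "d \<le> t * (a + b)" using \<open>0 < t\<close> by (simp add: power2_eq_square)
    also have "\<dots> < d" using \<open>0 < d\<close> \<open>0 \<le> a\<close> \<open>0 \<le> b\<close>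
      by (simp add: t_def divide_simps)
    finally show False by simp
  qed
  have "P $ j $ i = P $ i $ j" for i j
    by (cases "i = j") (auto intro: antisym le)
  then have "transpose P = P"
    by (simp add: vec_eq_iff transpose_def)
  with nonneg show ?thesis by (simp add: pos_semidef_def)
qed

lemma pos_semidef_sqrt_exists:
  fixes S :: "real ^ 'n ^ 'n"
  shows "\<exists>P. pos_semidef P \<and> P ** P = S ** transpose S"
proof -
  have "continuous_on {U. orthogonal_matrix U} (\<lambda>U. trace (S ** U))"
    unfolding trace_def matrix_matrix_mult_def by (simp, intro continuous_intros)
  moreover have "{U :: real ^ 'n ^ 'n. orthogonal_matrix U} \<noteq> {}"
    using orthogonal_matrix_id by blast
  ultimately obtain U where U: "orthogonal_matrix U"
    and max: "\<And>V. orthogonal_matrix V \<Longrightarrow> trace (S ** V) \<le> trace (S ** U)"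
    using continuous_attains_sup[OF compact_orthogonal_matrices] by blast
  have psd: "pos_semidef (S ** U)"
  proof (rule pos_semidef_if_trace_maximal)
    fix Q :: "real ^ 'n ^ 'n"
    assume "orthogonal_matrix Q"
    \<comment> \<open>\<open>U ** Q\<close> is again orthogonal, so it competes with
      \<open>U\<close> in the maximum.\<close>
    with U max show "trace (S ** U ** Q) \<le> trace (S ** U)"
      by (simp add: orthogonal_matrix_mul flip: matrix_mul_assoc)
  qed
  \<comment> \<open>Symmetry of \<open>S ** U\<close> turns its square into a product in which
    \<open>U\<close> cancels against its transpose.\<close>
  then have "S ** U ** (S ** U) = S ** U ** transpose (S ** U)"
    by (simp add: pos_semidef_def)
  also have "\<dots> = S ** (U ** transpose U) ** transpose S"
    by (simp add: matrix_transpose_mul matrix_mul_assoc)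
  also have "\<dots> = S ** transpose S"
    using U by (simp add: orthogonal_matrix_def)
  finally show ?thesis using psd by blast
qed

section \<open>Uniqueness of the square root\<close>

lemma pos_semidef_inner_commute:
  assumes "pos_semidef B"
  shows "x \<bullet> (B *v y) = (B *v x) \<bullet> y"
  using assms by (metis dot_lmul_matrix pos_semidef_def vector_transpose_matrix)

text \<open>A zero of the form is a minimum. Moving from \<open>x\<close> by
  \<open>- t *\<^sub>R (B *v x)\<close> changes the form by a first-order term
  \<open>- 2 * t\<close> times the squared length of \<open>B *v x\<close>, so for small
  \<open>t\<close> it would become negative unless that vector is 0.\<close>

lemma pos_semidef_kernel:
  assumes B: "pos_semidef B" and x: "x \<bullet> (B *v x) = 0"
  shows "B *v x = 0"
proof (rule ccontr)
  define y where "y = B *v x"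
  define c where "c = y \<bullet> (B *v y)"
  assume "B *v x \<noteq> 0"
  then have pos: "0 < y \<bullet> y" by (simp add: y_def)
  have "0 \<le> c" using B by (simp add: c_def pos_semidef_def)
  define t where "t = y \<bullet> y / (c + 1)"
  have "0 < t" using pos \<open>0 \<le> c\<close> by (simp add: t_def)
  have "0 \<le> (x - t *\<^sub>R y) \<bullet> (B *v (x - t *\<^sub>R y))"
    using B by (simp add: pos_semidef_def)
  also have "\<dots> = t * (t * c - 2 * (y \<bullet> y))"
    using x pos_semidef_inner_commute[OF B, of x y]
    by (simp add: matrix_vector_mult_diff_distrib matrix_vector_mult_scaleR inner_diff_left
        inner_diff_right c_def algebra_simps flip: y_def)
  finally have "2 * (y \<bullet> y) \<le> t * c"
    using \<open>0 < t\<close> by (simp add: zero_le_mult_iff)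
  also have "\<dots> \<le> y \<bullet> y"
    using pos \<open>0 \<le> c\<close> by (simp add: t_def divide_simps)
  finally show False using pos by simp
qed

text \<open>With \<open>D = B - C\<close>, the equation \<open>B\<^sup>2 = C\<^sup>2\<close> reads \<open>B D + D C = 0\<close>, so the positive semidefinite
  matrices \<open>D B D\<close> and \<open>D C D\<close> have traces adding up to zero.\<close>

lemma pos_semidef_sqrt_unique:
  fixes B C :: "real ^ 'n ^ 'n"
  assumes B: "pos_semidef B" and C: "pos_semidef C" and eq: "B ** B = C ** C"
  shows "B = C"
proof -
  define D where "D = B - C"
  have symD: "transpose D = D"
    using B C by (simp add: D_def pos_semidef_def transpose_def vec_eq_iff)
  \<comment> \<open>The columns of \<open>D\<close> serve as test vectors: summed over
    \<open>i\<close>, the forms give the trace of \<open>D ** (M ** D)\<close>.\<close>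
  have entry: "column i D \<bullet> (M *v column i D) = (D ** (M ** D)) $ i $ i" for M i
    using symD
    by (simp add: vec_eq_iff matrix_matrix_mult_def transpose_def column_def inner_vec_def
        matrix_vector_mult_def)
  have "D ** (B ** D) + D ** (D ** C) = 0"
    by (simp add: D_def matrix_mult_diff_left matrix_mult_diff_right eq)
  then have "trace (D ** (B ** D)) + trace (D ** (D ** C)) = 0"
    by (metis trace_add trace_0 mat_0)
  moreover have "trace (D ** (D ** C)) = trace (D ** (C ** D))"
    by (metis matrix_mul_assoc trace_mul_sym)
  ultimately have sum0:
    "(\<Sum>i\<in>UNIV. column i D \<bullet> (B *v column i D) + column i D \<bullet> (C *v column i D)) = 0"
    unfolding entry by (simp add: trace_def sum.distrib)
  have nonneg: "0 \<le> x \<bullet> (B *v x)" "0 \<le> x \<bullet> (C *v x)" for x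
    using B C by (auto simp: pos_semidef_def)
  have "column i D = 0" for i
  proof -
    have "column i D \<bullet> (B *v column i D) + column i D \<bullet> (C *v column i D) = 0"
      using sum0 nonneg by (subst (asm) sum_nonneg_eq_0_iff) (auto intro: add_nonneg_nonneg)
    then have "column i D \<bullet> (B *v column i D) = 0" "column i D \<bullet> (C *v column i D) = 0"
      using nonneg[of "column i D"] by auto
    then have "B *v column i D = 0" "C *v column i D = 0"
      using pos_semidef_kernel B C by blast+
    \<comment> \<open>Hence the square of \<open>D\<close> vanishes, and its diagonal holds the
      squared lengths of the columns.\<close>
    then have "D *v column i D = 0"
      by (simp add: D_def matrix_vector_mult_diff_rdistrib)
    moreover have "(D *v column i D) $ i = column i D \<bullet> column i D"
      using symD
      by (simp add: vec_eq_iff transpose_def column_def inner_vec_def matrix_vector_mult_def)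
    ultimately show ?thesis by simp
  qed
  then have "D = 0" by (simp add: vec_eq_iff column_def)
  then show ?thesis by (simp add: D_def)
qed

lemma psd_sqrt_eqI:
  assumes "pos_semidef P" "P ** P = A"
  shows "psd_sqrt A = P"
  unfolding psd_sqrt_def using assms pos_semidef_sqrt_unique by blast

text \<open>Existence and uniqueness together give the definite description in
  \<open>psd_sqrt\<close> its intended value.\<close>

lemma matrix_abs_symmetric:
  assumes "transpose S = S"
  shows "pos_semidef (matrix_abs S)" "matrix_abs S ** matrix_abs S = S ** S"
  using pos_semidef_sqrt_exists[of S] psd_sqrt_eqI assms unfolding matrix_abs_def by metis+

section \<open>Seidel matrices and the energy bound\<close>

lemma transpose_seidel_matrix:
  assumes "simple_graph adj"
  shows "transpose (seidel_matrix adj) = seidel_matrix adj"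
  using assms by (auto simp: simple_graph_def seidel_matrix_def transpose_def vec_eq_iff dest: sympD)

lemma seidel_matrix_square_diag:
  fixes adj :: "'n::finite \<Rightarrow> 'n \<Rightarrow> bool"
  assumes "simple_graph adj"
  shows "(seidel_matrix adj ** seidel_matrix adj) $ i $ i = real CARD('n) - 1"
proof -
  have "(seidel_matrix adj ** seidel_matrix adj) $ i $ i
      = (\<Sum>k\<in>UNIV. seidel_matrix adj $ i $ k * transpose (seidel_matrix adj) $ k $ i)"
    by (simp add: transpose_seidel_matrix[OF assms] matrix_matrix_mult_def)
  also have "\<dots> = (\<Sum>k\<in>UNIV. 1 - (if i = k then 1 else 0))"
    by (intro sum.cong) (auto simp: seidel_matrix_def transpose_def)
  also have "\<dots> = real CARD('n) - 1"
    by (simp add: sum_subtractf)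
  finally show ?thesis .
qed

lemma pos_semidef_scaled_mat: "0 \<le> c \<Longrightarrow> pos_semidef (c *\<^sub>R mat 1 :: real ^ 'n ^ 'n)"
  by (simp add: pos_semidef_def transpose_scalar flip: scaleR_matrix_vector_assoc)

theorem theorem3:
  fixes adj :: "'n::finite \<Rightarrow> 'n \<Rightarrow> bool"
  assumes "simple_graph adj"
  shows "(\<forall>i. vertex_seidel_energy adj i \<le> sqrt (real CARD('n) - 1)) \<and>
    ((\<forall>i. vertex_seidel_energy adj i = sqrt (real CARD('n) - 1)) \<longleftrightarrow>
      seidel_matrix adj ** seidel_matrix adj = (real CARD('n) - 1) *\<^sub>R mat 1)"
proof -
  define P where "P = matrix_abs (seidel_matrix adj)"
  define r where "r = sqrt (real CARD('n) - 1)"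
  \<comment> \<open>The vertex type is nonempty, so the radicand is nonnegative.\<close>
  have r: "0 \<le> r" "r * r = real CARD('n) - 1"
    by (simp_all add: r_def)
  have psd: "pos_semidef P" and sq: "P ** P = seidel_matrix adj ** seidel_matrix adj"
    unfolding P_def by (rule matrix_abs_symmetric[OF transpose_seidel_matrix[OF assms]])+
  then have sym: "P $ i $ j = P $ j $ i" for i j
    by (simp add: pos_semidef_def transpose_def vec_eq_iff)
  have row: "(\<Sum>k\<in>UNIV. (P $ i $ k)\<^sup>2) = r\<^sup>2" for i
    using seidel_matrix_square_diag[OF assms, of i] unfolding sq[symmetric]
    by (simp add: matrix_matrix_mult_def power2_eq_square r sym[of _ i])
  then have row': "(P $ i $ i)\<^sup>2 + (\<Sum>k\<in>UNIV - {i}. (P $ i $ k)\<^sup>2) = r\<^sup>2" for i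
    by (subst sum.remove[symmetric]) simp_all
  have "P $ i $ i \<le> r" for i
  proof (rule power2_le_imp_le)
    show "(P $ i $ i)\<^sup>2 \<le> r\<^sup>2"
      using row'[of i] sum_nonneg[of "UNIV - {i}" "\<lambda>k. (P $ i $ k)\<^sup>2"] by simp
  qed (fact r)
  moreover have "P ** P = (real CARD('n) - 1) *\<^sub>R mat 1" if "\<forall>i. P $ i $ i = r"
  proof -
    have "P $ i $ j = 0" if "i \<noteq> j" for i j
    proof -
      \<comment> \<open>The diagonal entry already uses up the whole squared length of the
        row.\<close>
      have "(\<Sum>k\<in>UNIV - {i}. (P $ i $ k)\<^sup>2) = 0"
        using row'[of i] \<open>\<forall>i. P $ i $ i = r\<close> by simp
      then show ?thesis using that by (simp add: sum_nonneg_eq_0_iff)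
    qed
    with that have "P = r *\<^sub>R mat 1"
      by (simp add: vec_eq_iff mat_def)
    then show ?thesis
      by (simp add: matrix_mult_scaleR r)
  qed
  moreover have "P $ i $ i = r" if "P ** P = (real CARD('n) - 1) *\<^sub>R mat 1" for i
  proof -
    \<comment> \<open>Both sides are positive semidefinite roots of the same matrix.\<close>
    have "P = r *\<^sub>R mat 1"
    proof (rule pos_semidef_sqrt_unique[OF psd pos_semidef_scaled_mat[OF r(1)]])
      show "P ** P = (r *\<^sub>R mat 1) ** (r *\<^sub>R mat 1)"
        by (simp add: that matrix_mult_scaleR r)
    qed
    then show ?thesis by (simp add: mat_def)
  qed
  ultimately show ?thesis
    unfolding vertex_seidel_energy_def P_def[symmetric] r_def[symmetric] sq[symmetric] by blast
qed

end
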